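(* Let $G$ be a cubic graph. Then there is a mapping $f: E(G)\to E(S)$ such that $|V(f)|\geq \frac{4}{5}|V(G)|$, and for every vertex $v\in V(G)\setminus V(f)$ there are two distinct edges $e,e'\in\partial_G(v)$ with $f(e)=f(e')$.
   Context: Graphs are finite, undirected, without loops but possibly with parallel edges; a cubic graph is $3$-regular. $\partial_X(x)$ denotes the set of edges of $X$ incident to the vertex $x$. $S$ is the Sylvester graph on $10$ vertices: it has a central vertex $c$ and, for each $i\in\{1,2,3\}$, vertices $x_i,y_i,z_i$ with two parallel edges between $x_i$ and $y_i$, edges $x_iz_i$, $y_iz_i$, and the edge $z_ic$ ($15$ edges in total). For a map $f:E(G)\to E(S)$, $V(f)=\{x\in V(G): \exists y\in V(S),\ f(\partial_G(x))=\partial_S(y)\}$. *)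

theory Defs
  imports Main
begin

definition multigraph :: "'v set \<Rightarrow> 'e set \<Rightarrow> ('e \<Rightarrow> 'v set) \<Rightarrow> bool" where
  "multigraph V E ends \<longleftrightarrow> finite V \<and> finite E \<and>
     (\<forall>e\<in>E. ends e \<subseteq> V \<and> card (ends e) = 2)"

definition incid :: "'e set \<Rightarrow> ('e \<Rightarrow> 'v set) \<Rightarrow> 'v \<Rightarrow> 'e set" where
  "incid E ends x = {e \<in> E. x \<in> ends e}"

definition cubic :: "'v set \<Rightarrow> 'e set \<Rightarrow> ('e \<Rightarrow> 'v set) \<Rightarrow> bool" where
  "cubic V E ends \<longleftrightarrow> multigraph V E ends \<and> (\<forall>v\<in>V. card (incid E ends v) = 3)"

datatype sv = SC | SX nat | SY nat | SZ nat
datatype se = SP1 nat | SP2 nat | SXZ nat | SYZ nat | SZC nat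

definition S_V :: "sv set" where
  "S_V = {SC} \<union> SX ` {1,2,3} \<union> SY ` {1,2,3} \<union> SZ ` {1,2,3}"

definition S_E :: "se set" where
  "S_E = SP1 ` {1,2,3} \<union> SP2 ` {1,2,3} \<union> SXZ ` {1,2,3} \<union> SYZ ` {1,2,3} \<union> SZC ` {1,2,3}"

fun S_ends :: "se \<Rightarrow> sv set" where
  "S_ends (SP1 i) = {SX i, SY i}"
| "S_ends (SP2 i) = {SX i, SY i}"
| "S_ends (SXZ i) = {SX i, SZ i}"
| "S_ends (SYZ i) = {SY i, SZ i}"
| "S_ends (SZC i) = {SZ i, SC}"

definition Vf :: "'v set \<Rightarrow> 'e set \<Rightarrow> ('e \<Rightarrow> 'v set) \<Rightarrow> ('e \<Rightarrow> se) \<Rightarrow> 'v set" where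
  "Vf V E ends f = {x \<in> V. \<exists>y\<in>S_V. f ` incid E ends x = incid S_E S_ends y}"

end

theory Submission
  imports Defs
begin

text \<open>
  Colouring with the three edges at the centre of \<open>S\<close>, a vertex is good as soon as its three edges
  get distinct colours. Take a partial proper 3-edge-colouring with as few uncoloured edges (holes)
  as possible. The two ends of a hole miss different colours and are joined by a Kempe chain, which
  together with the hole forms an odd cycle. These cycles are pairwise disjoint: a hole can be moved
  along its cycle, and if two cycles met, moving one hole to a suitable meeting point would cut the
  Kempe chain of the other. Filling every hole with the colour missing at one of its ends creates one
  bad vertex per cycle, so if there are no triangles, all cycles have at least five vertices and at
  most a fifth of the vertices are bad.

  Triangles are removed by induction. A triangle without parallel edges is contracted, and a colouring
  extends back without increasing the number of bad vertices. A triangle with a doubled edge hangs on a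
  bridge; it is replaced by a leaf and later coloured like the end block of \<open>S\<close> that contains
  the colour of the bridge.
\<close>

section \<open>Components of graphs with maximum degree two\<close>

text \<open>A connected graph of maximum degree two is a path or a cycle, and a path has only two
  ends. The induction deletes the edge at the end \<open>x\<close>, whose neighbour \<open>w\<close>
  then takes over the role of \<open>x\<close>. Singletons such as \<open>{y0}\<close> express
  degree at most one.\<close>

lemma path_component_ends:
  assumes "finite R" "sym R" "irrefl R"
    and "\<And>v. \<exists>a b. R `` {v} \<subseteq> {a, b}"
    and "R `` {x} \<subseteq> {w0}"
    and "(x, y) \<in> R\<^sup>*" "y \<noteq> x" "R `` {y} \<subseteq> {y0}"
    and "(x, z) \<in> R\<^sup>*" "z \<noteq> x" "R `` {z} \<subseteq> {z0}"
  shows "y = z"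
  using assms
proof (induction "card R" arbitrary: R x w0 y0 z0 rule: less_induct)
  case less
  obtain w where xw: "(x, w) \<in> R"
    using less.prems(6,7) by (metis converse_rtranclE)
  then have wx: "(w, x) \<in> R" and "w \<noteq> x"
    using less.prems(2,3) by (auto dest: symD simp: irrefl_def)
  have Rx: "R `` {x} = {w}" using less.prems(5) xw by blast
  define R' where "R' = R - {(x, w), (w, x)}"
  have "R' \<subset> R" using xw by (auto simp: R'_def)
  then have card: "card R' < card R" using less.prems(1) by (simp add: psubset_card_mono)
  \<comment> \<open>A walk from \<open>x\<close> goes to \<open>w\<close> at once, and later visits
    to \<open>x\<close> can be cut out.\<close>
  have reach: "t = x \<or> (w, t) \<in> R'\<^sup>*" if "(x, t) \<in> R\<^sup>*" for t
    using that
  proof (induction rule: rtrancl_induct)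
    case (step s t)
    show ?case
    proof (cases "(s, t) \<in> R'")
      case True
      moreover have "s \<noteq> x" using True Rx by (auto simp: R'_def)
      ultimately show ?thesis using step.IH by (meson rtrancl.rtrancl_into_rtrancl)
    next
      case False
      then show ?thesis using step.hyps(2) by (auto simp: R'_def)
    qed
  qed simp
  have y: "(w, y) \<in> R'\<^sup>*" and z: "(w, z) \<in> R'\<^sup>*"
    using reach less.prems by blast+
  \<comment> \<open>If \<open>w\<close> is itself an end, its only edge was the deleted one.\<close>
  have isolated: "t = w" if "R `` {w} \<subseteq> {a}" "(w, t) \<in> R'\<^sup>*" for a t
  proof -
    have "R' `` {w} = {}" using that(1) wx by (auto simp: R'_def)
    then show ?thesis using that(2) by (metis Image_singleton_iff converse_rtranclE empty_iff)
  qed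
  consider "y = w" | "z = w" | "y \<noteq> w" "z \<noteq> w" by blast
  then show ?case
  proof cases
    case 1
    then show ?thesis using isolated less.prems(8) z by blast
  next
    case 2
    then show ?thesis using isolated less.prems(11) y by blast
  next
    case 3
    have sub: "R' \<subseteq> R" by (auto simp: R'_def)
    obtain a b where "R `` {w} \<subseteq> {a, b}" using less.prems(4) by blast
    \<comment> \<open>\<open>x\<close> is one of \<open>a\<close> and \<open>b\<close>; the other
      one is all that can remain next to \<open>w\<close>.\<close>
    then have "R' `` {w} \<subseteq> {if x = a then b else a}"
      using wx by (auto simp: R'_def)
    moreover have "finite R'" using less.prems(1) by (simp add: R'_def)
    moreover have "sym R'" using less.prems(2) by (auto simp: R'_def sym_def)
    moreover have "irrefl R'" using less.prems(3) by (auto simp: R'_def irrefl_def)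
    moreover have "\<exists>a b. R' `` {v} \<subseteq> {a, b}" for v
      using less.prems(4)[of v] sub by (meson Image_mono order_refl subset_trans)
    moreover have "R' `` {y} \<subseteq> {y0}" "R' `` {z} \<subseteq> {z0}"
      using less.prems(8,11) sub by blast+
    ultimately show ?thesis
      using less.hyps[OF card] y z 3 by blast
  qed
qed

section \<open>Partial edge colourings and their holes\<close>

datatype colour = Red | Green | Blue

definition swap_colour :: "colour \<Rightarrow> colour \<Rightarrow> colour option \<Rightarrow> colour option" where
  "swap_colour a b o' = (if o' = Some a then Some b else if o' = Some b then Some a else o')"

lemma swap_colour_None [simp]: "swap_colour a b o' = None \<longleftrightarrow> o' = None"
  by (auto simp: swap_colour_def)

text \<open>In a multigraph the three vertices are distinct, since every edge has two ends. A
  further edge parallel to a side is allowed.\<close>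

definition triangle :: "'e set \<Rightarrow> ('e \<Rightarrow> 'v set) \<Rightarrow> 'v \<Rightarrow> 'v \<Rightarrow> 'v \<Rightarrow> bool" where
  "triangle E ends x y z \<longleftrightarrow> (\<exists>e\<in>E. ends e = {x, y}) \<and> (\<exists>e\<in>E. ends e = {y, z}) \<and> (\<exists>e\<in>E. ends e = {x, z})"

locale subcubic =
  fixes V :: "'v set" and E :: "'e set" and ends :: "'e \<Rightarrow> 'v set"
  assumes graph: "multigraph V E ends"
    and degree: "v \<in> V \<Longrightarrow> card (incid E ends v) \<le> 3"
begin

definition proper :: "('e \<Rightarrow> colour option) \<Rightarrow> bool" where
  "proper c \<longleftrightarrow> (\<forall>v. \<forall>e\<in>E. \<forall>e'\<in>E. v \<in> ends e \<longrightarrow> v \<in> ends e' \<longrightarrow> c e = c e' \<longrightarrow> c e \<noteq> None \<longrightarrow> e = e')"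

definition holes :: "('e \<Rightarrow> colour option) \<Rightarrow> 'e set" where
  "holes c = {e \<in> E. c e = None}"

definition optimal :: "('e \<Rightarrow> colour option) \<Rightarrow> bool" where
  "optimal c \<longleftrightarrow> proper c \<and> (\<forall>c'. proper c' \<longrightarrow> card (holes c) \<le> card (holes c'))"

definition misses :: "('e \<Rightarrow> colour option) \<Rightarrow> 'v \<Rightarrow> colour \<Rightarrow> bool" where
  "misses c v a \<longleftrightarrow> (\<forall>e\<in>E. v \<in> ends e \<longrightarrow> c e \<noteq> Some a)"

text \<open>As a relation on vertices this identifies parallel edges. Chains are used only through
  reachability and bounds on the number of neighbours, which survive the identification.\<close>

definition kempe_adj :: "('e \<Rightarrow> colour option) \<Rightarrow> colour \<Rightarrow> colour \<Rightarrow> ('v \<times> 'v) set" where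
  "kempe_adj c a b = {(v, w). \<exists>e\<in>E. ends e = {v, w} \<and> (c e = Some a \<or> c e = Some b)}"

definition kempe :: "('e \<Rightarrow> colour option) \<Rightarrow> colour \<Rightarrow> colour \<Rightarrow> 'v \<Rightarrow> 'v set" where
  "kempe c a b x = (kempe_adj c a b)\<^sup>* `` {x}"

definition flip :: "'e set \<Rightarrow> colour \<Rightarrow> colour \<Rightarrow> ('e \<Rightarrow> colour option) \<Rightarrow> 'e \<Rightarrow> colour option" where
  "flip C a b c e = (if e \<in> C then swap_colour a b (c e) else c e)"

lemma finite_V: "finite V" and finite_E: "finite E"
  using graph by (auto simp: multigraph_def)

lemma ends_in_V: "e \<in> E \<Longrightarrow> v \<in> ends e \<Longrightarrow> v \<in> V"
  using graph by (auto simp: multigraph_def)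

lemma edge_ends:
  assumes "e \<in> E"
  obtains v w where "ends e = {v, w}" "v \<noteq> w"
  using graph assms by (metis multigraph_def card_2_iff)

lemma edge_other_end:
  assumes "e \<in> E" "v \<in> ends e"
  obtains w where "ends e = {v, w}" "v \<noteq> w"
  using edge_ends[OF assms(1)] assms(2) by (metis doubleton_eq_iff insertE singletonD)

lemma ends_distinct: "e \<in> E \<Longrightarrow> ends e = {v, w} \<Longrightarrow> v \<noteq> w"
  using graph by (auto simp: multigraph_def)

lemma finite_holes: "finite (holes c)"
  using finite_E by (simp add: holes_def)

lemma properD:
  "proper c \<Longrightarrow> e \<in> E \<Longrightarrow> e' \<in> E \<Longrightarrow> v \<in> ends e \<Longrightarrow> v \<in> ends e' \<Longrightarrow> c e = Some a \<Longrightarrow> c e' = Some a \<Longrightarrow> e = e'"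
  unfolding proper_def by (metis option.distinct(1))

lemma properI:
  assumes "\<And>v e e' a. e \<in> E \<Longrightarrow> e' \<in> E \<Longrightarrow> v \<in> ends e \<Longrightarrow> v \<in> ends e' \<Longrightarrow> c e = Some a \<Longrightarrow> c e' = Some a \<Longrightarrow> e = e'"
  shows "proper c"
  unfolding proper_def using assms by (metis not_None_eq)

lemma optimal_exists: "\<exists>c. optimal c"
proof -
  have "proper (\<lambda>_. None)" by (rule properI) simp
  then show ?thesis
    using ex_has_least_nat[of proper "\<lambda>_. None" "\<lambda>c. card (holes c)"]
    unfolding optimal_def by blast
qed

lemma optimal_same_holes:
  "optimal c \<Longrightarrow> proper c' \<Longrightarrow> card (holes c') = card (holes c) \<Longrightarrow> optimal c'"
  by (simp add: optimal_def)

lemma optimal_proper: "optimal c \<Longrightarrow> proper c"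
  by (simp add: optimal_def)

section \<open>Kempe chains and the exchange of two colours\<close>

lemma kempe_adj_sym: "sym (kempe_adj c a b)"
  by (auto simp: sym_def kempe_adj_def insert_commute)

lemma kempe_adj_commute: "kempe_adj c a b = kempe_adj c b a"
  by (auto simp: kempe_adj_def)

lemma kempe_adj_irrefl: "irrefl (kempe_adj c a b)"
  using ends_distinct by (fastforce simp: irrefl_def kempe_adj_def)

lemma kempe_adj_subset: "kempe_adj c a b \<subseteq> V \<times> V"
  using ends_in_V by (fastforce simp: kempe_adj_def)

lemma finite_kempe_adj: "finite (kempe_adj c a b)"
  using kempe_adj_subset finite_V by (meson finite_SigmaI finite_subset)

lemma kempe_refl: "x \<in> kempe c a b x"
  by (simp add: kempe_def)

lemma kempe_eq:
  assumes "y \<in> kempe c a b x"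
  shows "kempe c a b y = kempe c a b x"
proof -
  have "sym ((kempe_adj c a b)\<^sup>*)" by (simp add: kempe_adj_sym sym_rtrancl)
  then show ?thesis using assms unfolding kempe_def
    by (auto dest: symD intro: rtrancl_trans)
qed

lemma kempe_commute: "kempe c a b x = kempe c b a x"
  by (simp add: kempe_def kempe_adj_commute)

lemma kempe_subset: "x \<in> V \<Longrightarrow> kempe c a b x \<subseteq> V"
proof
  fix v assume "x \<in> V" "v \<in> kempe c a b x"
  then have "(x, v) \<in> (kempe_adj c a b)\<^sup>*" by (simp add: kempe_def)
  then show "v \<in> V" using \<open>x \<in> V\<close> kempe_adj_subset
    by (induction rule: rtrancl_induct) auto
qed

lemma kempe_closed:
  assumes "e \<in> E" "v \<in> ends e" "v \<in> kempe c a b x" "c e = Some a \<or> c e = Some b"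
  shows "ends e \<subseteq> kempe c a b x"
proof -
  obtain w where "ends e = {v, w}" using edge_other_end assms(1,2) by metis
  moreover have "(v, w) \<in> kempe_adj c a b"
    using assms calculation by (auto simp: kempe_adj_def)
  ultimately show ?thesis
    using assms(3) by (auto simp: kempe_def intro: rtrancl_into_rtrancl)
qed

lemma colour_neighbour:
  assumes "proper c"
  obtains s where "\<And>e w. e \<in> E \<Longrightarrow> ends e = {v, w} \<Longrightarrow> c e = Some a \<Longrightarrow> w = s"
proof (cases "\<exists>e s. e \<in> E \<and> ends e = {v, s} \<and> c e = Some a")
  case True
  then obtain g s where g: "g \<in> E" "ends g = {v, s}" "c g = Some a" by blast
  have "w = s" if "e \<in> E" "ends e = {v, w}" "c e = Some a" for e w
  proof -
    have "e = g" using properD[OF assms, of e g v] that g by simp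
    then show ?thesis using that g by (metis doubleton_eq_iff)
  qed
  then show ?thesis using that by blast
next
  case False
  then show ?thesis using that by blast
qed

lemma kempe_adj_deg2:
  assumes "proper c"
  shows "\<exists>s t. kempe_adj c a b `` {v} \<subseteq> {s, t}"
proof -
  obtain s where "\<And>e w. e \<in> E \<Longrightarrow> ends e = {v, w} \<Longrightarrow> c e = Some a \<Longrightarrow> w = s"
    using colour_neighbour[OF assms, of v a] by blast
  moreover obtain t where "\<And>e w. e \<in> E \<Longrightarrow> ends e = {v, w} \<Longrightarrow> c e = Some b \<Longrightarrow> w = t"
    using colour_neighbour[OF assms, of v b] by blast
  ultimately have "kempe_adj c a b `` {v} \<subseteq> {s, t}" by (auto simp: kempe_adj_def)
  then show ?thesis by (intro exI)
qed

lemma kempe_adj_deg1: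
  assumes "proper c" "misses c v a \<or> misses c v b"
  shows "\<exists>s. kempe_adj c a b `` {v} \<subseteq> {s}"
proof -
  \<comment> \<open>\<open>d\<close> is the one colour of the pair that may still occur at
    \<open>v\<close>.\<close>
  obtain d where d: "\<And>e. e \<in> E \<Longrightarrow> v \<in> ends e \<Longrightarrow> c e = Some a \<or> c e = Some b \<Longrightarrow> c e = Some d"
    using assms(2) unfolding misses_def by metis
  obtain s where "\<And>e w. e \<in> E \<Longrightarrow> ends e = {v, w} \<Longrightarrow> c e = Some d \<Longrightarrow> w = s"
    using colour_neighbour[OF assms(1), of v d] by blast
  then have "kempe_adj c a b `` {v} \<subseteq> {s}" using d by (auto simp: kempe_adj_def)
  then show ?thesis by (intro exI)
qed

text \<open>A vertex missing one of the two colours is an end of its chain, and no chain has three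
  ends. Most contradictions about holes below come from a third end.\<close>

lemma kempe_two_ends:
  assumes "proper c"
    and "misses c x a \<or> misses c x b"
    and "y \<in> kempe c a b x" "y \<noteq> x" "misses c y a \<or> misses c y b"
    and "z \<in> kempe c a b x" "z \<noteq> x" "misses c z a \<or> misses c z b"
  shows "y = z"
proof -
  obtain x0 y0 z0 where "kempe_adj c a b `` {x} \<subseteq> {x0}"
    "kempe_adj c a b `` {y} \<subseteq> {y0}" "kempe_adj c a b `` {z} \<subseteq> {z0}"
    using kempe_adj_deg1 assms by metis
  then show ?thesis
    using path_component_ends[OF finite_kempe_adj kempe_adj_sym kempe_adj_irrefl kempe_adj_deg2[OF assms(1)]]
      assms by (auto simp: kempe_def)
qed

lemma holes_flip [simp]: "holes (flip C a b c) = holes c"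
  by (auto simp: holes_def flip_def)

text \<open>No edge coloured \<open>a\<close> or \<open>b\<close> outside \<open>C\<close> touches
  \<open>C\<close>, so a clash across the border would be in the third colour, which the exchange
  leaves alone.\<close>

lemma proper_flip:
  assumes "proper c"
    and "\<And>v e e'. e \<in> C \<Longrightarrow> v \<in> ends e \<Longrightarrow> e' \<in> E \<Longrightarrow> v \<in> ends e' \<Longrightarrow> c e' = Some a \<or> c e' = Some b \<Longrightarrow> e' \<in> C"
  shows "proper (flip C a b c)"
proof (rule properI)
  fix v e e' d
  assume e: "e \<in> E" "e' \<in> E" "v \<in> ends e" "v \<in> ends e'"
    and d: "flip C a b c e = Some d" "flip C a b c e' = Some d"
  have "c e = c e'"
  proof (cases "e \<in> C \<longleftrightarrow> e' \<in> C")
    case True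
    then show ?thesis using d by (auto simp: flip_def swap_colour_def split: if_splits)
  next
    case False
    then have "d \<noteq> a" "d \<noteq> b"
      using d assms(2)[of e v e'] assms(2)[of e' v e] e by (auto simp: flip_def)
    then show ?thesis using d by (auto simp: flip_def swap_colour_def split: if_splits)
  qed
  moreover have "c e \<noteq> None" using d by (auto simp: flip_def swap_colour_def split: if_splits)
  ultimately show "e = e'" using properD[OF assms(1)] e by (metis not_None_eq)
qed

lemma misses_flip:
  assumes "misses c v a"
    and "\<And>e. e \<in> E \<Longrightarrow> v \<in> ends e \<Longrightarrow> c e = Some b \<Longrightarrow> e \<in> C"
  shows "misses (flip C a b c) v b" "misses (flip C b a c) v b"
  using assms by (auto simp: misses_def flip_def swap_colour_def split: if_splits)

section \<open>Holes of an optimal colouring\<close>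

text \<open>Otherwise the hole could be given the colour \<open>a\<close>, and fewer holes would
  remain.\<close>

lemma hole_no_common_missing:
  assumes "optimal c" "e \<in> holes c" "ends e = {x, y}" "misses c x a"
  shows "\<not> misses c y a"
proof
  assume "misses c y a"
  then have "proper (c(e := Some a))"
    using optimal_proper[OF assms(1)] assms(3,4) unfolding proper_def misses_def
    by (metis fun_upd_apply insertE singletonD)
  moreover have "holes (c(e := Some a)) = holes c - {e}"
    by (auto simp: holes_def)
  moreover have "card (holes c - {e}) < card (holes c)"
    using assms(2) finite_holes by (meson card_Diff1_less)
  ultimately show False using assms(1) by (metis optimal_def not_less)
qed

text \<open>If the chain of \<open>x\<close> avoided \<open>y\<close>, exchanging its colours would
  let both ends of the hole miss \<open>b\<close> without creating a new hole.\<close>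

lemma hole_kempe:
  assumes "optimal c" "e \<in> holes c" "ends e = {x, y}" "misses c x a" "misses c y b"
  shows "y \<in> kempe c a b x"
proof (rule ccontr)
  define K where "K = kempe c a b x"
  assume "y \<notin> kempe c a b x"
  then have "y \<notin> K" by (simp add: K_def)
  have closed: "ends e' \<subseteq> K" if "e' \<in> E" "v \<in> ends e'" "v \<in> K" "c e' = Some a \<or> c e' = Some b" for e' v
    using kempe_closed that unfolding K_def by metis
  \<comment> \<open>Holes and edges of the third colour may lie in \<open>C\<close>; the exchange
    fixes them.\<close>
  define C where "C = {e \<in> E. ends e \<subseteq> K}"
  define c' where "c' = flip C a b c"
  have "proper c'" unfolding c'_def
    by (rule proper_flip) (use closed optimal_proper[OF assms(1)] in \<open>auto simp: C_def\<close>)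
  then have "optimal c'" using assms(1) by (simp add: optimal_same_holes c'_def)
  moreover have "e \<in> holes c'" using assms(2) by (simp add: c'_def)
  moreover have "misses c' x b" unfolding c'_def
    by (rule misses_flip(1)[OF assms(4)])
      (use closed kempe_refl in \<open>auto simp: C_def K_def\<close>)
  moreover have "misses c' y b"
    using assms(5) \<open>y \<notin> K\<close> by (auto simp: misses_def c'_def flip_def C_def)
  ultimately show False using hole_no_common_missing assms(3) by blast
qed

text \<open>At most two edges at \<open>v\<close> besides the hole cannot carry three
  colours.\<close>

lemma hole_end_misses:
  assumes "e \<in> holes c" "v \<in> ends e"
  shows "\<exists>a. misses c v a"
proof (rule ccontr)
  assume "\<nexists>a. misses c v a"
  then obtain g where g: "\<And>a. g a \<in> E \<and> v \<in> ends (g a) \<and> c (g a) = Some a"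
    unfolding misses_def by metis
  have "{e, g Red, g Green, g Blue} \<subseteq> incid E ends v"
    using g assms by (auto simp: incid_def holes_def)
  then have "card {e, g Red, g Green, g Blue} \<le> card (incid E ends v)"
    using finite_E by (intro card_mono) (auto simp: incid_def)
  moreover have "card {e, g Red, g Green, g Blue} = 4"
  proof -
    have "c e = None" using assms by (simp add: holes_def)
    then have "e \<noteq> g a" for a using g by (metis option.distinct(1))
    moreover have "g a = g b \<Longrightarrow> a = b" for a b using g by (metis option.inject)
    ultimately show ?thesis by (auto simp: card_insert_if)
  qed
  moreover have "v \<in> V" using assms ends_in_V by (auto simp: holes_def)
  ultimately show False using degree[of v] by simp
qed

text \<open>Two holes leave room for at most one coloured edge at \<open>v\<close>; its colour is
  \<open>d\<close>.\<close>

lemma double_hole_misses: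
  assumes "e \<in> holes c" "e' \<in> holes c" "e \<noteq> e'" "v \<in> ends e" "v \<in> ends e'"
  shows "\<exists>d. \<forall>a. a \<noteq> d \<longrightarrow> misses c v a"
proof (rule ccontr)
  assume *: "\<nexists>d. \<forall>a. a \<noteq> d \<longrightarrow> misses c v a"
  then obtain a b where "a \<noteq> b" "\<not> misses c v a" "\<not> misses c v b" by metis
  then obtain g h where g: "g \<in> E" "v \<in> ends g" "c g = Some a" and h: "h \<in> E" "v \<in> ends h" "c h = Some b"
    by (auto simp: misses_def)
  have "{e, e', g, h} \<subseteq> incid E ends v"
    using g h assms by (auto simp: incid_def holes_def)
  then have "card {e, e', g, h} \<le> card (incid E ends v)"
    using finite_E by (intro card_mono) (auto simp: incid_def)
  moreover have "card {e, e', g, h} = 4"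
    using g h assms \<open>a \<noteq> b\<close> by (auto simp: card_insert_if holes_def)
  moreover have "v \<in> V" using g ends_in_V by auto
  ultimately show False using degree[of v] by simp
qed

text \<open>Two holes at \<open>x\<close> would make \<open>x\<close> miss every colour except some
  \<open>d\<close>, which forces both other ends to miss \<open>d\<close>. They and \<open>x\<close>
  would then be three ends of one chain.\<close>

lemma holes_matching:
  assumes "optimal c" "e \<in> holes c" "e' \<in> holes c" "x \<in> ends e" "x \<in> ends e'"
  shows "e = e'"
proof (rule ccontr)
  assume ne: "e \<noteq> e'"
  have E: "e \<in> E" "e' \<in> E" using assms by (auto simp: holes_def)
  obtain y y' where y: "ends e = {x, y}" "x \<noteq> y" and y': "ends e' = {x, y'}" "x \<noteq> y'"
    using edge_other_end E assms(4,5) by metis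
  obtain d where d: "\<And>a. a \<noteq> d \<Longrightarrow> misses c x a"
    using double_hole_misses[OF assms(2,3) ne assms(4,5)] by blast
  have my: "misses c y d" "a \<noteq> d \<Longrightarrow> \<not> misses c y a" for a
    using hole_end_misses[OF assms(2), of y] hole_no_common_missing[OF assms(1,2) y(1)] d y by (metis insertCI)+
  have my': "misses c y' d"
    using hole_end_misses[OF assms(3), of y'] hole_no_common_missing[OF assms(1,3) y'(1)] d y' by (metis insertCI)
  \<comment> \<open>Parallel holes would make \<open>y\<close> miss at least two colours, but it
    misses only \<open>d\<close>.\<close>
  have "y \<noteq> y'"
  proof
    assume "y = y'"
    then obtain d' where "\<And>a. a \<noteq> d' \<Longrightarrow> misses c y a"
      using double_hole_misses[OF assms(2,3) ne, of y] y y' by auto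
    then have "a = d \<or> a = d'" for a using my by blast
    from this[of Red] this[of Green] this[of Blue] show False by (cases d; cases d') auto
  qed
  obtain a where "a \<noteq> d" by (cases d) auto
  then have "y \<in> kempe c a d x" "y' \<in> kempe c a d x"
    using hole_kempe assms d y y' my my' by blast+
  then show False
    using kempe_two_ends[OF optimal_proper[OF assms(1)], of x a d y y'] \<open>y \<noteq> y'\<close> d[OF \<open>a \<noteq> d\<close>] my my' y y'
    by blast
qed

text \<open>Lets the two ends of a hole exchange their roles when chains of different holes are
  compared.\<close>

lemma hole_kempe_sym:
  assumes "optimal c" "e \<in> holes c" "ends e = {x, y}" "misses c x a" "misses c y b"
  shows "kempe c b a y = kempe c a b x"
  using kempe_eq[OF hole_kempe[OF assms]] by (simp add: kempe_commute)

text \<open>The Kempe chain of a hole closes up with it to an odd cycle, and the hole can be moved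
  to any place on that cycle.\<close>

lemma hole_rotation:
  assumes "optimal c" "u \<in> holes c" "ends u = {x, y}" "misses c x a" "misses c y b"
    and "p \<in> kempe c a b x"
  obtains c' where "optimal c'" "misses c' p b"
    and "\<And>e. c' e \<noteq> c e \<Longrightarrow> ends e \<subseteq> kempe c a b x"
    and "\<And>e d. d \<noteq> a \<Longrightarrow> d \<noteq> b \<Longrightarrow> c' e = Some d \<Longrightarrow> c e = Some d"
proof -
  define K where "K = kempe c a b x"
  \<comment> \<open>The edges of the cycle that the chain forms together with
    \<open>u\<close>.\<close>
  define C where "C = {e \<in> E. ends e \<subseteq> K \<and> (c e = Some a \<or> c e = Some b \<or> e = u)}"
  \<comment> \<open>A colouring with the hole of the cycle at \<open>h\<close> and unchanged off the
    cycle. The colours missed at \<open>p\<close> and \<open>q\<close> fix how the two colours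
    alternate.\<close>
  define inv where "inv c' h p q \<longleftrightarrow> proper c' \<and> h \<in> C \<and> ends h = {p, q} \<and> c' h = None
      \<and> (\<forall>e\<in>C - {h}. c' e = Some a \<or> c' e = Some b) \<and> (\<forall>e. e \<notin> C \<longrightarrow> c' e = c e)
      \<and> misses c' p b \<and> misses c' q a" for c' h p q
  have u: "u \<in> E" "c u = None" using assms(2) by (auto simp: holes_def)
  have "ends u \<subseteq> K"
    using hole_kempe[OF assms(1-5)] assms(3) kempe_refl by (auto simp: K_def)
  then have uC: "u \<in> C" using u by (simp add: C_def)
  have closed: "e \<in> C" if "e \<in> E" "v \<in> ends e" "v \<in> K" "c' e = Some a \<or> c' e = Some b" "inv c' h p q"
    for c' h p q e v
  proof (rule ccontr)
    assume "e \<notin> C"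
    then have "c e = Some a \<or> c e = Some b" using that by (auto simp: inv_def)
    then have "ends e \<subseteq> K" using kempe_closed that unfolding K_def by metis
    then show False using \<open>e \<notin> C\<close> \<open>c e = Some a \<or> c e = Some b\<close> \<open>e \<in> E\<close> by (simp add: C_def)
  qed
  \<comment> \<open>Exchanging the colours along the whole cycle lets the ends of the hole trade
    their missing colours.\<close>
  have flip_inv: "inv (flip C a b c') h q p" if i: "inv c' h p q" for c' h p q
  proof -
    have "p \<in> K" "q \<in> K" and m: "misses c' p b" "misses c' q a"
      using i by (auto simp: inv_def C_def)
    have "proper (flip C a b c')"
      by (rule proper_flip) (use i closed[OF _ _ _ _ i] in \<open>auto simp: inv_def C_def\<close>)
    moreover have "misses (flip C a b c') q b"
      by (rule misses_flip(1)) (use m closed[OF _ _ \<open>q \<in> K\<close> _ i] in blast)+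
    moreover have "misses (flip C a b c') p a"
      by (rule misses_flip(2)) (use m closed[OF _ _ \<open>p \<in> K\<close> _ i] in blast)+
    ultimately show ?thesis using i
      by (auto simp: inv_def flip_def swap_colour_def insert_commute)
  qed
  \<comment> \<open>The target is reached along the original chain, one edge \<open>g\<close> at a
    time. If the hole already sits on \<open>g\<close>, an exchange suffices.\<close>
  have step: "\<exists>c' h q. inv c' h p' q" if i: "inv c' h p q" and pp: "(p, p') \<in> kempe_adj c a b" for c' h p q p'
  proof -
    obtain g where g: "g \<in> E" "ends g = {p, p'}" "c g = Some a \<or> c g = Some b"
      using pp by (auto simp: kempe_adj_def)
    have "p \<in> K" using i by (auto simp: inv_def C_def)
    then have "ends g \<subseteq> K" using kempe_closed g unfolding K_def by (metis insertI1)
    then have gC: "g \<in> C" using g by (auto simp: C_def)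
    show ?thesis
    proof (cases "g = h")
      case True
      then have "p' = q" using i g by (auto simp: inv_def doubleton_eq_iff)
      then show ?thesis using flip_inv[OF i] by blast
    next
      case False
      have hC: "h \<in> E" "ends h = {p, q}" "c' h = None" "proper c'" "misses c' q a" "misses c' p b"
        using i by (auto simp: inv_def C_def)
      have ga: "c' g = Some a"
        using i g gC False by (auto simp: inv_def misses_def)
      \<comment> \<open>The hole moves from \<open>h\<close> to \<open>g\<close>, and
        \<open>h\<close> takes the colour \<open>a\<close> from \<open>g\<close>. This is allowed
        because \<open>q\<close> misses \<open>a\<close> and \<open>g\<close> was the only
        \<open>a\<close>-edge at \<open>p\<close>.\<close>
      define c2 where "c2 = c'(g := None, h := Some a)"
      have "e = h" if "e \<in> E" "v \<in> ends e" "v \<in> ends h" "c2 e = Some a" for e v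
      proof (rule ccontr)
        assume "e \<noteq> h"
        then have "e \<noteq> g" "c' e = Some a" using that by (auto simp: c2_def split: if_splits)
        then have "v = p" using that hC by (auto simp: misses_def)
        then have "e = g" using properD[OF hC(4), of e g p] that g \<open>c' e = Some a\<close> ga by simp
        then show False using \<open>e \<noteq> g\<close> by simp
      qed
      moreover have "c2 e = Some d \<Longrightarrow> e \<noteq> h \<Longrightarrow> c' e = Some d" for e d
        by (auto simp: c2_def split: if_splits)
      moreover have "c2 h = Some a" by (simp add: c2_def)
      ultimately have "proper c2"
        using properD[OF hC(4)] by (intro properI) (metis option.inject)
      moreover have "a \<noteq> b" using hC ga g by (auto simp: misses_def)
      then have "misses c2 p b" using hC by (auto simp: misses_def c2_def)
      moreover have "misses c2 p' a"
      proof -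
        have "h \<noteq> e \<Longrightarrow> c' e = Some a \<Longrightarrow> e \<in> E \<Longrightarrow> p' \<in> ends e \<Longrightarrow> e = g" for e
          using properD[OF hC(4), of e g p'] g ga by auto
        moreover have "p' \<notin> ends h"
        proof
          assume "p' \<in> ends h"
          then have "p' = q" using hC ends_distinct[OF g(1,2)] by auto
          then show False using hC(5) g ga by (auto simp: misses_def)
        qed
        ultimately show ?thesis by (auto simp: misses_def c2_def)
      qed
      ultimately have "inv c2 g p p'"
        using i g gC False by (auto simp: inv_def c2_def)
      then show ?thesis using flip_inv by blast
    qed
  qed
  \<comment> \<open>At first \<open>y\<close> is the end missing \<open>b\<close>. One exchange
    makes it \<open>x\<close>, where the walk to \<open>p\<close> begins.\<close>
  have "inv c u y x"
    using assms(1,3-5) u uC by (auto simp: inv_def C_def optimal_def insert_commute)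
  then have "inv (flip C a b c) u x y" by (rule flip_inv)
  moreover have "(x, p) \<in> (kempe_adj c a b)\<^sup>*" using assms(6) by (simp add: kempe_def)
  then have "(\<exists>c' h q. inv c' h x q) \<Longrightarrow> \<exists>c' h q. inv c' h p q"
    by (induction rule: rtrancl_induct) (use step in blast)+
  ultimately obtain c' h q where i: "inv c' h p q" by blast
  \<comment> \<open>One hole has moved and none was created, so optimality is kept.\<close>
  have "holes c' = insert h (holes c - {u})"
  proof (rule set_eqI)
    fix e
    have h: "h \<in> E" "h \<in> C" "c' h = None" using i by (auto simp: inv_def C_def)
    show "e \<in> holes c' \<longleftrightarrow> e \<in> insert h (holes c - {u})"
    proof (cases "e \<in> C")
      case True
      moreover have "\<forall>e\<in>C - {h}. c' e = Some a \<or> c' e = Some b" using i by (simp add: inv_def)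
      ultimately have "c' e = None \<longleftrightarrow> e = h" using h by (metis DiffI option.distinct(1) singletonD)
      moreover have "c e = None \<longleftrightarrow> e = u" using True u by (auto simp: C_def)
      ultimately show ?thesis using True h by (auto simp: holes_def C_def)
    next
      case False
      then have "c' e = c e" using i by (simp add: inv_def)
      then show ?thesis using False h uC by (auto simp: holes_def)
    qed
  qed
  moreover have "h \<notin> holes c - {u}" using i by (auto simp: inv_def holes_def C_def)
  ultimately have "card (holes c') = card (holes c)"
    using assms(2) finite_holes[of c] by (metis card.remove card_insert_disjoint finite_Diff)
  then have "optimal c'" using optimal_same_holes assms(1) i unfolding inv_def by blast
  moreover have "misses c' p b" using i by (simp add: inv_def)
  moreover have "ends e \<subseteq> kempe c a b x" if "c' e \<noteq> c e" for e
    using i that by (auto simp: inv_def C_def K_def)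
  moreover have "c e = Some d" if "d \<noteq> a" "d \<noteq> b" "c' e = Some d" for e d
    using i that unfolding inv_def by (metis DiffI option.distinct(1) option.inject singletonD)
  ultimately show ?thesis using that by blast
qed

section \<open>Disjointness of the chains of different holes\<close>

text \<open>Follow the second chain from \<open>x'\<close> to its first vertex \<open>p\<close> on
  the first chain. Rotating the hole \<open>u\<close> makes \<open>p\<close> miss \<open>b\<close>
  and keeps the walk up to \<open>p\<close>, so the second chain gets a third end besides
  \<open>x'\<close> and \<open>y'\<close>.\<close>

lemma kempe_disjoint_mixed:
  assumes "optimal c"
    and u: "u \<in> holes c" "ends u = {x, y}" "misses c x a" "misses c y b"
    and u': "u' \<in> holes c" "ends u' = {x', y'}" "misses c x' b" "misses c y' d"
    and "u \<noteq> u'" "d \<noteq> a" "d \<noteq> b"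
  shows "kempe c a b x \<inter> kempe c b d x' = {}"
proof (rule ccontr)
  define K where "K = kempe c a b x"
  define R where "R = kempe_adj c b d"
  \<comment> \<open>The part of the second chain that avoids \<open>K\<close>; the rotation does not
    affect it.\<close>
  define R' where "R' = R \<inter> (- K) \<times> (- K)"
  assume "kempe c a b x \<inter> kempe c b d x' \<noteq> {}"
  then obtain t where t: "t \<in> K" "(x', t) \<in> R\<^sup>*" by (auto simp: K_def kempe_def R_def)
  have pc: "proper c" by (rule optimal_proper[OF assms(1)])
  have uE: "u \<in> E" "u' \<in> E" using u u' by (auto simp: holes_def)
  \<comment> \<open>Since \<open>x'\<close> misses \<open>b\<close>, on \<open>K\<close> it would be
    a third end besides \<open>x\<close> and \<open>y\<close>.\<close>
  have x': "x' \<notin> K"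
  proof
    assume "x' \<in> K"
    moreover have "x' \<notin> ends u" using holes_matching[OF assms(1) u(1) u'(1)] u'(2) \<open>u \<noteq> u'\<close> by blast
    moreover have "y \<in> K" using hole_kempe[OF assms(1) u] by (simp add: K_def)
    ultimately show False
      using kempe_two_ends[OF pc, of x a b x' y] u u' ends_distinct[OF uE(1) u(2)] by (auto simp: K_def)
  qed
  have "(x', t) \<in> R'\<^sup>* \<or> (\<exists>q p. (x', q) \<in> R'\<^sup>* \<and> q \<notin> K \<and> p \<in> K \<and> (q, p) \<in> R)"
    using t(2)
  proof (induction rule: rtrancl_induct)
    case (step s t)
    have "s \<notin> K" if "(x', s) \<in> R'\<^sup>*"
      using that x' by (induction rule: rtrancl_induct) (auto simp: R'_def)
    then show ?case using step by (cases "t \<in> K") (auto simp: R'_def intro: rtrancl_into_rtrancl)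
  qed simp
  moreover have "(x', t) \<notin> R'\<^sup>*"
  proof
    assume "(x', t) \<in> R'\<^sup>*"
    then have "t \<notin> K" using x' by (induction rule: rtrancl_induct) (auto simp: R'_def)
    then show False using t by simp
  qed
  ultimately obtain q p where qp: "(x', q) \<in> R'\<^sup>*" "q \<notin> K" "p \<in> K" "(q, p) \<in> R" by blast
  obtain g where g: "g \<in> E" "ends g = {q, p}" "c g = Some b \<or> c g = Some d"
    using qp(4) by (auto simp: R_def kempe_adj_def)
  \<comment> \<open>An edge of colour \<open>b\<close> at \<open>p\<close> would stay inside
    \<open>K\<close>.\<close>
  have "c g = Some d"
    using g qp(2,3) kempe_closed[of g p c a b x] by (auto simp: K_def)
  then have "p \<noteq> y'" using u'(4) g by (auto simp: misses_def)
  obtain c' where c': "optimal c'" "misses c' p b"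
    and same: "\<And>e. c' e \<noteq> c e \<Longrightarrow> ends e \<subseteq> K"
    and cd: "\<And>e. c' e = Some d \<Longrightarrow> c e = Some d"
    using hole_rotation[OF assms(1) u qp(3)[unfolded K_def]] \<open>d \<noteq> a\<close> \<open>d \<noteq> b\<close> unfolding K_def by metis
  have same': "c' e = c e" if "v \<in> ends e" "v \<notin> K" for e v
    using same that by blast
  have sub: "(v, w) \<in> kempe_adj c' b d" if "(v, w) \<in> R" "v \<notin> K" for v w
    using that same' by (fastforce simp: R_def kempe_adj_def)
  have "R' \<subseteq> kempe_adj c' b d" using sub by (auto simp: R'_def)
  then have "(x', q) \<in> (kempe_adj c' b d)\<^sup>*" using qp(1) rtrancl_mono by blast
  then have "p \<in> kempe c' b d x'"
    using sub[OF qp(4,2)] by (auto simp: kempe_def intro: rtrancl_into_rtrancl)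
  moreover have "misses c' x' b" using u'(3) same' x' by (metis misses_def)
  moreover have "misses c' y' d" using u'(4) cd by (auto simp: misses_def)
  moreover have "u' \<in> holes c'" using u' same'[of x' u'] x' by (auto simp: holes_def)
  \<comment> \<open>Beyond \<open>p\<close> the chain may have changed, so the optimality of
    \<open>c'\<close> is used to find \<open>y'\<close> on it again.\<close>
  moreover have "y' \<in> kempe c' b d x'"
    by (rule hole_kempe[OF c'(1)]) fact+
  moreover have "y' \<noteq> x'" using ends_distinct[OF uE(2) u'(2)] by simp
  moreover have "p \<noteq> x'" using qp x' by blast
  ultimately show False
    using kempe_two_ends[OF optimal_proper[OF c'(1)], of x' b d p y'] c'(2) \<open>p \<noteq> y'\<close> by blast
qed

text \<open>For equal colour pairs, chains that meet coincide, and \<open>x'\<close> would be a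
  third end besides \<open>x\<close> and \<open>y\<close>.\<close>

lemma kempe_disjoint_same:
  assumes "optimal c"
    and u: "u \<in> holes c" "ends u = {x, y}" "misses c x a" "misses c y b"
    and u': "u' \<in> holes c" "x' \<in> ends u'" "misses c x' a \<or> misses c x' b"
    and "u \<noteq> u'"
  shows "kempe c a b x \<inter> kempe c a b x' = {}"
proof (rule ccontr)
  assume "kempe c a b x \<inter> kempe c a b x' \<noteq> {}"
  then have "kempe c a b x' = kempe c a b x" using kempe_eq by blast
  then have "x' \<in> kempe c a b x" using kempe_refl by metis
  moreover have "x' \<notin> ends u" using holes_matching[OF assms(1) u(1) u'(1)] u'(2) \<open>u \<noteq> u'\<close> by blast
  moreover have "y \<in> kempe c a b x" by (rule hole_kempe[OF assms(1) u])
  moreover have "x \<noteq> y" using u ends_distinct by (auto simp: holes_def)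
  ultimately show False
    using kempe_two_ends[OF optimal_proper[OF assms(1)], of x a b x' y] u u' by auto
qed

text \<open>Two pairs out of three colours agree or share exactly one colour. In the latter case,
  exchanging the ends of the holes puts the shared colour where \<open>kempe_disjoint_mixed\<close>
  wants it.\<close>

lemma kempe_disjoint:
  assumes "optimal c"
    and u: "u \<in> holes c" "ends u = {x, y}" "misses c x a" "misses c y b"
    and u': "u' \<in> holes c" "ends u' = {x', y'}" "misses c x' a'" "misses c y' b'"
    and "u \<noteq> u'"
  shows "kempe c a b x \<inter> kempe c a' b' x' = {}"
proof -
  have uy: "ends u = {y, x}" "ends u' = {y', x'}" using u u' by auto
  note K = hole_kempe_sym[OF assms(1) u]
  note K' = hole_kempe_sym[OF assms(1) u']
  have "a \<noteq> b" "a' \<noteq> b'"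
    using hole_no_common_missing[OF assms(1)] u u' by blast+
  then consider "a' = a" "b' = b" | "a' = b" "b' = a" | "a' = b" "b' \<noteq> a" "b' \<noteq> b"
    | "b' = b" "a' \<noteq> a" "a' \<noteq> b" | "a' = a" "b' \<noteq> a" "b' \<noteq> b" | "b' = a" "a' \<noteq> a" "a' \<noteq> b"
    by (cases a; cases b; cases a'; cases b') auto
  then show ?thesis
  proof cases
    case 1
    then show ?thesis using kempe_disjoint_same[OF assms(1) u u'(1), of x'] u' \<open>u \<noteq> u'\<close> by auto
  next
    case 2
    then show ?thesis using kempe_disjoint_same[OF assms(1) u u'(1), of x'] u' \<open>u \<noteq> u'\<close>
      by (auto simp: kempe_commute[of c b a])
  next
    case 3
    then show ?thesis using kempe_disjoint_mixed[OF assms(1) u u'(1,2)] u' \<open>u \<noteq> u'\<close> by auto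
  next
    case 4
    then show ?thesis using kempe_disjoint_mixed[OF assms(1) u u'(1) uy(2)] u' \<open>u \<noteq> u'\<close> K' by auto
  next
    case 5
    then show ?thesis using kempe_disjoint_mixed[OF assms(1) u(1) uy(1) u(4,3) u'(1,2)] u' \<open>u \<noteq> u'\<close> K by auto
  next
    case 6
    have "kempe c b a y \<inter> kempe c a a' y' = {}"
      by (rule kempe_disjoint_mixed[OF assms(1) u(1) uy(1) u(4,3) u'(1) uy(2)])
        (use 6 u' \<open>u \<noteq> u'\<close> in auto)
    then show ?thesis using 6 K K' by simp
  qed
qed

section \<open>Length of the chains and the count of bad vertices\<close>

text \<open>The chain leaves \<open>x\<close> by colour \<open>b\<close> towards \<open>w\<close>
  and \<open>y\<close> by colour \<open>a\<close> towards \<open>v\<close>. Without triangles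
  \<open>w\<close> and \<open>v\<close> differ. As \<open>w\<close> is not an end, it has an
  \<open>a\<close>-neighbour \<open>t\<close>, the fifth vertex.\<close>

lemma card_kempe:
  assumes "optimal c" "\<And>x y z. \<not> triangle E ends x y z"
    and u: "u \<in> holes c" "ends u = {x, y}" "misses c x a" "misses c y b"
  shows "5 \<le> card (kempe c a b x)"
proof -
  define K where "K = kempe c a b x"
  have uE: "u \<in> E" "c u = None" using u by (auto simp: holes_def)
  have pc: "proper c" by (rule optimal_proper[OF assms(1)])
  have xK: "x \<in> K" by (simp add: K_def kempe_refl)
  have yK: "y \<in> K" using hole_kempe[OF assms(1) u] by (simp add: K_def)
  have closed: "w \<in> K" if "e \<in> E" "ends e = {v, w}" "v \<in> K" "c e = Some a \<or> c e = Some b" for e v w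
    using kempe_closed[OF that(1), of v] that by (auto simp: K_def)
  have xy: "x \<noteq> y" using ends_distinct uE u by blast
  have "\<not> misses c x b" using hole_no_common_missing[OF assms(1) u(1), of y x b] u by auto
  then obtain g w where g: "g \<in> E" "ends g = {x, w}" "c g = Some b" "x \<noteq> w"
    unfolding misses_def using edge_other_end by metis
  have "\<not> misses c y a" using hole_no_common_missing[OF assms(1) u(1,2,3)] .
  then obtain h v where h: "h \<in> E" "ends h = {y, v}" "c h = Some a" "y \<noteq> v"
    unfolding misses_def using edge_other_end by metis
  have wK: "w \<in> K" and vK: "v \<in> K" using closed g h xK yK by blast+
  have wy: "w \<noteq> y" using g u(4) by (auto simp: misses_def)
  have vx: "v \<noteq> x" using h u(3) by (auto simp: misses_def)
  have wv: "w \<noteq> v"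
  proof
    assume "w = v"
    then have "triangle E ends x y w" using uE u g h unfolding triangle_def by blast
    then show False using assms(2) by blast
  qed
  have "\<not> misses c w a"
  proof
    assume "misses c w a"
    moreover have "w \<in> kempe c a b x" using wK by (simp add: K_def)
    ultimately show False
      using kempe_two_ends[OF pc, of x a b w y] u yK wy xy g(4) by (auto simp: K_def)
  qed
  then obtain k t where k: "k \<in> E" "ends k = {w, t}" "c k = Some a" "w \<noteq> t"
    unfolding misses_def using edge_other_end by metis
  have tK: "t \<in> K" using closed k wK by blast
  have "t \<noteq> x" using k u(3) by (auto simp: misses_def)
  \<comment> \<open>\<open>y\<close> and \<open>v\<close> already share the \<open>a\<close>-edge
    \<open>h\<close>, so the \<open>a\<close>-edge \<open>k\<close> avoids both.\<close>
  moreover have "t \<noteq> y"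
    using properD[OF pc k(1) h(1), of y a] k h wv by (auto simp: doubleton_eq_iff)
  moreover have "t \<noteq> v"
    using properD[OF pc k(1) h(1), of v a] k h wy by (auto simp: doubleton_eq_iff)
  ultimately have "card {x, y, w, v, t} = 5"
    using xy g(4) h(4) wy vx wv k(4) by auto
  moreover have "{x, y, w, v, t} \<subseteq> K" using xK yK wK vK tK by blast
  moreover have "finite K"
    using kempe_subset[of x c a b] ends_in_V[OF uE(1), of x] u finite_V
    by (auto simp: K_def intro: finite_subset)
  ultimately show ?thesis unfolding K_def by (metis card_mono)
qed

theorem near_proper_colouring:
  assumes "\<And>x y z. \<not> triangle E ends x y z"
  shows "\<exists>f :: 'e \<Rightarrow> colour. 5 * card {v \<in> V. \<not> inj_on f (incid E ends v)} \<le> card V"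
proof -
  obtain c where c: "optimal c" using optimal_exists by blast
  have pc: "proper c" by (rule optimal_proper[OF c])
  have "\<exists>x y a b. ends u = {x, y} \<and> misses c x a \<and> misses c y b" if "u \<in> holes c" for u
  proof -
    have "u \<in> E" using that by (simp add: holes_def)
    then obtain x y where "ends u = {x, y}" using edge_ends by blast
    then show ?thesis using hole_end_misses[OF that] by (metis insertCI)
  qed
  then obtain X Y A B where XY: "\<And>u. u \<in> holes c \<Longrightarrow> ends u = {X u, Y u} \<and> misses c (X u) (A u) \<and> misses c (Y u) (B u)"
    by metis
  define K where "K u = kempe c (A u) (B u) (X u)" for u
  \<comment> \<open>Each hole takes the colour missed at its end \<open>X\<close>, so a repetition
    can arise only at its end \<open>Y\<close>.\<close>
  define f where "f e = (case c e of Some d \<Rightarrow> d | None \<Rightarrow> A e)" for e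
  have f_inj: "e = e'"
    if "v \<in> V" "v \<notin> Y ` holes c" "e \<in> E" "e' \<in> E" "v \<in> ends e" "v \<in> ends e'" "f e = f e'" for v e e'
  proof -
    have hole: "v = X u" "misses c v (A u)" "f u = A u" if "u \<in> holes c" "v \<in> ends u" for u
      using XY[OF that(1)] that \<open>v \<notin> Y ` holes c\<close> by (auto simp: f_def holes_def)
    have eq: "c e = Some (f e)" if "e \<notin> holes c" "e \<in> E" for e
      using that by (auto simp: holes_def f_def)
    show ?thesis
    proof (cases "e \<in> holes c")
      case True
      show ?thesis
      proof (cases "e' \<in> holes c")
        case e': True
        then show ?thesis using holes_matching[OF c True e'] that by blast
      next
        case False
        then show ?thesis using hole[OF True] eq[of e'] that by (auto simp: misses_def)
      qed
    next
      case False
      show ?thesis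
      proof (cases "e' \<in> holes c")
        case e': True
        then show ?thesis using hole[OF e'] eq[OF False] that by (auto simp: misses_def)
      next
        case e': False
        then show ?thesis using eq[OF e'] eq[OF False] that properD[OF pc, of e e' v "f e"] by auto
      qed
    qed
  qed
  have "{v \<in> V. \<not> inj_on f (incid E ends v)} \<subseteq> Y ` holes c"
  proof
    fix v assume "v \<in> {v \<in> V. \<not> inj_on f (incid E ends v)}"
    then obtain e e' where "v \<in> V" "e \<in> E" "e' \<in> E" "v \<in> ends e" "v \<in> ends e'" "f e = f e'" "e \<noteq> e'"
      by (auto simp: inj_on_def incid_def)
    then show "v \<in> Y ` holes c" using f_inj by blast
  qed
  then have bad: "card {v \<in> V. \<not> inj_on f (incid E ends v)} \<le> card (holes c)"
    using finite_holes by (meson card_image_le card_mono finite_imageI le_trans)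
  have KV: "K u \<subseteq> V" if "u \<in> holes c" for u
  proof -
    have "X u \<in> V" using XY[OF that] ends_in_V[of u "X u"] that by (auto simp: holes_def)
    then show ?thesis unfolding K_def by (rule kempe_subset)
  qed
  \<comment> \<open>Each hole pays for its bad vertex with at least five vertices of its own
    chain.\<close>
  have "5 * card (holes c) = (\<Sum>u\<in>holes c. 5)" by simp
  also have "\<dots> \<le> (\<Sum>u\<in>holes c. card (K u))"
    by (rule sum_mono) (use card_kempe[OF c assms] XY in \<open>simp add: K_def\<close>)
  also have "\<dots> = card (\<Union>u\<in>holes c. K u)"
  proof (rule card_UN_disjoint[symmetric])
    show "\<forall>u\<in>holes c. finite (K u)" using KV finite_V by (meson finite_subset)
    show "\<forall>u\<in>holes c. \<forall>u'\<in>holes c. u \<noteq> u' \<longrightarrow> K u \<inter> K u' = {}"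
      using kempe_disjoint[OF c] XY unfolding K_def by blast
  qed (rule finite_holes)
  also have "\<dots> \<le> card V" using KV finite_V by (intro card_mono) auto
  finally show ?thesis using bad by (intro exI[of _ f]) linarith
qed

end

section \<open>Vertex stars of the Sylvester graph\<close>

definition stars :: "se set set" where
  "stars = incid S_E S_ends ` S_V"

lemma stars_eq:
  "stars = {{SZC 1, SZC 2, SZC 3}} \<union> (\<Union>i\<in>{1,2,3}. {{SP1 i, SP2 i, SXZ i}, {SP1 i, SP2 i, SYZ i}, {SXZ i, SYZ i, SZC i}})"
proof -
  have "incid S_E S_ends SC = {SZC 1, SZC 2, SZC 3}"
    by (auto simp: incid_def S_E_def)
  moreover have "incid S_E S_ends (SX i) = {SP1 i, SP2 i, SXZ i}"
    "incid S_E S_ends (SY i) = {SP1 i, SP2 i, SYZ i}"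
    "incid S_E S_ends (SZ i) = {SXZ i, SYZ i, SZC i}" if "i \<in> {1, 2, 3}" for i
    using that by (auto simp: incid_def S_E_def)
  ultimately show ?thesis by (auto simp: stars_def S_V_def)
qed

lemma centre_star: "{SZC 1, SZC 2, SZC 3} \<in> stars"
  by (simp add: stars_eq)

lemma claw_stars:
  assumes "i \<in> {1, 2, 3}"
  shows "{SP1 i, SP2 i, SXZ i} \<in> stars" "{SP1 i, SP2 i, SYZ i} \<in> stars" "{SXZ i, SYZ i, SZC i} \<in> stars"
  using assms unfolding stars_eq by blast+

text \<open>Every edge of \<open>S\<close> has an end in some end block, and the star of that vertex
  contains it.\<close>

lemma star_through:
  assumes "s \<in> S_E"
  shows "\<exists>p\<in>S_E. \<exists>q\<in>S_E. {s, p, q} \<in> stars"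
proof -
  obtain i where i: "i \<in> {1, 2, 3}" and s: "s \<in> {SP1 i, SP2 i, SXZ i, SYZ i, SZC i}"
    using assms unfolding S_E_def by blast
  have "{SP1 i, SP2 i, SXZ i, SYZ i, SZC i} \<subseteq> S_E" using i by (auto simp: S_E_def)
  moreover have "\<exists>p\<in>{SP1 i, SP2 i, SXZ i, SYZ i, SZC i}. \<exists>q\<in>{SP1 i, SP2 i, SXZ i, SYZ i, SZC i}. {s, p, q} \<in> stars"
    using s claw_stars[OF i] by (auto simp: insert_commute)
  ultimately show ?thesis by blast
qed

text \<open>Here \<open>s1\<close>, \<open>s2\<close>, \<open>s3\<close> are the colours of the
  edges leaving a triangle, and each \<open>t\<close> belongs to the side opposite the vertex of the
  same number. If the \<open>s\<close> form a star, opposite sides copy them and all three vertices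
  see this star. If two of them agree, a star through the common colour serves both of these
  vertices and repeats a colour at the third.\<close>

lemma star_triangle_extension:
  assumes "s1 \<in> S_E" "s2 \<in> S_E" "s3 \<in> S_E"
    and "{s1, s2, s3} \<in> stars \<or> s1 = s2 \<or> s2 = s3 \<or> s1 = s3"
  obtains t1 t2 t3 where "t1 \<in> S_E" "t2 \<in> S_E" "t3 \<in> S_E"
    and "{s1, t2, t3} \<in> stars \<or> t2 = t3" "{s2, t1, t3} \<in> stars \<or> t1 = t3" "{s3, t1, t2} \<in> stars \<or> t1 = t2"
    and "{s1, s2, s3} \<in> stars \<Longrightarrow> {s1, t2, t3} \<in> stars \<and> {s2, t1, t3} \<in> stars \<and> {s3, t1, t2} \<in> stars"
    and "{s1, t2, t3} \<in> stars \<and> {s2, t1, t3} \<in> stars \<or> {s2, t1, t3} \<in> stars \<and> {s3, t1, t2} \<in> stars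
      \<or> {s1, t2, t3} \<in> stars \<and> {s3, t1, t2} \<in> stars"
proof (cases "{s1, s2, s3} \<in> stars")
  case True
  then have "{s2, s1, s3} \<in> stars" "{s3, s1, s2} \<in> stars" by (simp_all add: insert_commute)
  then show ?thesis using that[of s1 s2 s3] True assms by blast
next
  case False
  then consider "s1 = s2" | "s2 = s3" | "s1 = s3" using assms(4) by blast
  then show ?thesis
  proof cases
    case 1
    obtain p q where "p \<in> S_E" "q \<in> S_E" "{s1, p, q} \<in> stars" using star_through assms(1) by blast
    then show ?thesis using that[of p p q] False 1 by blast
  next
    case 2
    obtain p q where "p \<in> S_E" "q \<in> S_E" "{s2, p, q} \<in> stars" using star_through assms(2) by blast
    then show ?thesis using that[of p q q] False 2 by blast
  next
    case 3
    obtain p q where "p \<in> S_E" "q \<in> S_E" "{s1, p, q} \<in> stars" "{s1, q, p} \<in> stars"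
      using star_through assms(1) by (metis insert_commute)
    then show ?thesis using that[of p q p] False 3 by blast
  qed
qed

section \<open>Removal of triangles\<close>

text \<open>Cutting off a doubled triangle creates a vertex of degree one, so the induction has to
  run over graphs with such leaves.\<close>

definition leafed_cubic :: "'v set \<Rightarrow> 'e set \<Rightarrow> ('e \<Rightarrow> 'v set) \<Rightarrow> bool" where
  "leafed_cubic V E ends \<longleftrightarrow> multigraph V E ends \<and> (\<forall>v\<in>V. card (incid E ends v) \<in> {1, 3})"

definition bad :: "'v set \<Rightarrow> 'e set \<Rightarrow> ('e \<Rightarrow> 'v set) \<Rightarrow> ('e \<Rightarrow> se) \<Rightarrow> 'v set" where
  "bad V E ends f = {v \<in> V. card (incid E ends v) = 3 \<and> f ` incid E ends v \<notin> stars}"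

text \<open>The condition on leaves allows a triangle with a doubled edge to be reattached at a leaf
  as a copy of an end block of the Sylvester graph.\<close>

definition near_sylvester :: "'v set \<Rightarrow> 'e set \<Rightarrow> ('e \<Rightarrow> 'v set) \<Rightarrow> ('e \<Rightarrow> se) \<Rightarrow> bool" where
  "near_sylvester V E ends f \<longleftrightarrow> f ` E \<subseteq> S_E \<and> 5 * card (bad V E ends f) \<le> card V
     \<and> (\<forall>v\<in>bad V E ends f. \<not> inj_on f (incid E ends v))
     \<and> (\<forall>v\<in>V. card (incid E ends v) = 1 \<longrightarrow> f ` incid E ends v \<subseteq> SZC ` {1, 2, 3})"

lemma third_edge:
  assumes "card (incid E ends v) \<in> {1, 3}" "e \<in> incid E ends v" "e' \<in> incid E ends v" "e \<noteq> e'"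
  obtains g where "incid E ends v = {e, e', g}" "g \<noteq> e" "g \<noteq> e'"
proof -
  have fin: "finite (incid E ends v)" using assms(1) card.infinite by fastforce
  then have "card {e, e'} \<le> card (incid E ends v)" using assms by (intro card_mono) auto
  then have "card (incid E ends v) = 3" using assms(1,4) by auto
  then have "card (incid E ends v - {e, e'}) = 1" using assms fin by (simp add: card_Diff_subset)
  then obtain g where "incid E ends v - {e, e'} = {g}" by (auto simp: card_1_singleton_iff)
  then show ?thesis using that[of g] assms(2,3) by blast
qed

text \<open>The three colours become the edges at the centre \<open>SC\<close>: a vertex that sees
  all of them is mapped to the central star, and every leaf edge automatically gets a colour allowed
  there.\<close>

lemma near_sylvester_triangle_free:
  fixes V :: "'v set" and E :: "'e set"
  assumes "leafed_cubic V E ends" "\<And>x y z. \<not> triangle E ends x y z"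
  shows "\<exists>f. near_sylvester V E ends f"
proof -
  have deg: "card (incid E ends v) = 1 \<or> card (incid E ends v) = 3" if "v \<in> V" for v
    using assms(1) that by (auto simp: leafed_cubic_def)
  interpret subcubic V E ends
  proof
    show "multigraph V E ends" using assms(1) by (simp add: leafed_cubic_def)
    show "card (incid E ends v) \<le> 3" if "v \<in> V" for v using deg[OF that] by auto
  qed
  obtain f :: "'e \<Rightarrow> colour" where f: "5 * card {v \<in> V. \<not> inj_on f (incid E ends v)} \<le> card V"
    using near_proper_colouring[OF assms(2)] by blast
  define h where "h d = SZC (case d of Red \<Rightarrow> 1 | Green \<Rightarrow> 2 | Blue \<Rightarrow> 3)" for d
  have inj: "inj h" by (auto simp: inj_def h_def split: colour.splits)
  have UNIV: "UNIV = {Red, Green, Blue}" using colour.exhaust by blast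
  have h: "h ` UNIV = {SZC 1, SZC 2, SZC 3}" unfolding UNIV by (simp add: h_def)
  have bad: "\<not> inj_on f (incid E ends v)" if "v \<in> bad V E ends (h \<circ> f)" for v
  proof
    assume "inj_on f (incid E ends v)"
    then have "card (f ` incid E ends v) = 3" using that by (simp add: bad_def card_image)
    moreover have "card (UNIV :: colour set) = 3" unfolding UNIV by simp
    moreover have "finite (UNIV :: colour set)" unfolding UNIV by simp
    ultimately have "f ` incid E ends v = UNIV" by (metis card_subset_eq subset_UNIV)
    then have "(h \<circ> f) ` incid E ends v \<in> stars" using h centre_star by (metis image_comp)
    then show False using that by (simp add: bad_def)
  qed
  have hS: "(h \<circ> f) e \<in> SZC ` {1, 2, 3}" for e using h by auto
  have "card (bad V E ends (h \<circ> f)) \<le> card {v \<in> V. \<not> inj_on f (incid E ends v)}"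
    by (rule card_mono) (use finite_V bad in \<open>auto simp: bad_def\<close>)
  moreover have "\<not> inj_on (h \<circ> f) (incid E ends v)" if "v \<in> bad V E ends (h \<circ> f)" for v
    using bad[OF that] inj_on_imageI2 by blast
  moreover have "(h \<circ> f) ` E \<subseteq> S_E" using hS by (fastforce simp: S_E_def)
  ultimately have "near_sylvester V E ends (h \<circ> f)"
    unfolding near_sylvester_def using f hS by (meson image_subsetI le_trans mult_le_mono2)
  then show ?thesis by blast
qed

text \<open>Removing \<open>x\<close> and \<open>y\<close> turns \<open>z\<close> into a leaf, whose
  edge \<open>C\<close> receives some \<open>SZC i\<close>. The deleted part is then coloured as the
  end block \<open>i\<close>, which makes \<open>x\<close>, \<open>y\<close> and \<open>z\<close>
  good.\<close>

lemma near_sylvester_doubled_triangle: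
  fixes V :: "'v set" and E :: "'e set"
  assumes G: "leafed_cubic V E ends"
    and ne: "x \<noteq> y" "y \<noteq> z" "x \<noteq> z"
    and E: "P \<in> E" "Q \<in> E" "A \<in> E" "B \<in> E" "P \<noteq> Q"
    and ends: "ends P = {x, y}" "ends Q = {x, y}" "ends A = {x, z}" "ends B = {y, z}"
    and IH: "\<And>(V' :: 'v set) (E' :: 'e set) ends'. card V' < card V \<Longrightarrow> leafed_cubic V' E' ends' \<Longrightarrow>
      \<exists>f. near_sylvester V' E' ends' f"
  shows "\<exists>f. near_sylvester V E ends f"
proof -
  have fin: "finite V" "finite E" and endsV: "\<And>e. e \<in> E \<Longrightarrow> ends e \<subseteq> V \<and> card (ends e) = 2"
    and deg: "\<And>v. v \<in> V \<Longrightarrow> card (incid E ends v) \<in> {1, 3}"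
    using G by (auto simp: leafed_cubic_def multigraph_def)
  have V: "x \<in> V" "y \<in> V" "z \<in> V" using endsV[OF E(3)] endsV[OF E(4)] ends by auto
  have AB: "A \<noteq> B" "A \<noteq> P" "A \<noteq> Q" "B \<noteq> P" "B \<noteq> Q"
    using ends ne by (metis doubleton_eq_iff)+
  obtain C where z: "incid E ends z = {A, B, C}" and C: "C \<noteq> A" "C \<noteq> B"
    by (rule third_edge[OF deg[OF V(3)], of A B]) (use E ends AB in \<open>auto simp: incid_def\<close>)
  obtain A' where "incid E ends x = {P, Q, A'}"
    by (rule third_edge[OF deg[OF V(1)], of P Q]) (use E ends AB in \<open>auto simp: incid_def\<close>)
  moreover have "A \<in> incid E ends x" using E ends by (auto simp: incid_def)
  ultimately have x: "incid E ends x = {P, Q, A}" using AB by auto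
  obtain B' where "incid E ends y = {P, Q, B'}"
    by (rule third_edge[OF deg[OF V(2)], of P Q]) (use E ends AB in \<open>auto simp: incid_def\<close>)
  moreover have "B \<in> incid E ends y" using E ends by (auto simp: incid_def)
  ultimately have y: "incid E ends y = {P, Q, B}" using AB by auto
  have CE: "C \<in> E" "z \<in> ends C" using z by (auto simp: incid_def)
  then have CP: "C \<noteq> P" "C \<noteq> Q" using ends ne by auto
  define V' where "V' = V - {x, y}"
  define E' where "E' = E - {P, Q, A, B}"
  have z': "incid E' ends z = {C}" using z C CP CE unfolding E'_def incid_def by blast
  have same: "incid E' ends v = incid E ends v" if "v \<notin> {x, y, z}" for v
    using that ends by (auto simp: incid_def E'_def)
  \<comment> \<open>The stars of \<open>x\<close> and \<open>y\<close> consist of deleted edges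
    only.\<close>
  have "ends e \<subseteq> V'" if "e \<in> E'" for e
  proof -
    have "e \<notin> incid E ends x" "e \<notin> incid E ends y" using that x y by (auto simp: E'_def)
    then show ?thesis using that endsV by (auto simp: E'_def V'_def incid_def)
  qed
  moreover have "card (incid E' ends v) \<in> {1, 3}" if "v \<in> V'" for v
    using that z' same[of v] deg[of v] by (cases "v = z") (auto simp: V'_def)
  ultimately have "leafed_cubic V' E' ends"
    using fin endsV by (auto simp: leafed_cubic_def multigraph_def V'_def E'_def)
  moreover have "V' \<subset> V" using V by (auto simp: V'_def)
  then have cV: "card V' < card V" using fin by (simp add: psubset_card_mono)
  ultimately obtain f' where f': "near_sylvester V' E' ends f'" using IH by blast
  have "z \<in> V'" using V ne by (auto simp: V'_def)
  then have "f' C \<in> SZC ` {1, 2, 3}" using f' z' by (auto simp: near_sylvester_def)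
  then obtain i where i: "i \<in> {1, 2, 3}" "f' C = SZC i" by blast
  define f where "f = f'(P := SP1 i, Q := SP2 i, A := SXZ i, B := SYZ i)"
  have fv: "f P = SP1 i" "f Q = SP2 i" "f A = SXZ i" "f B = SYZ i" "f C = SZC i"
    using AB E(5) C CP i by (auto simp: f_def)
  have ff': "f e = f' e" if "e \<in> E'" for e using that by (auto simp: f_def E'_def)
  have img: "f ` incid E ends v = f' ` incid E' ends v" if "v \<notin> {x, y, z}" for v
    unfolding same[OF that, symmetric] by (rule image_cong) (auto simp: ff' incid_def)
  have good: "f ` incid E ends x \<in> stars" "f ` incid E ends y \<in> stars" "f ` incid E ends z \<in> stars"
    unfolding x y z using claw_stars[OF i(1)] fv by auto
  have bad: "bad V E ends f \<subseteq> bad V' E' ends f'"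
  proof
    fix v assume v: "v \<in> bad V E ends f"
    then have "v \<notin> {x, y, z}" using good by (auto simp: bad_def)
    then show "v \<in> bad V' E' ends f'" using v img[of v] same[of v] by (auto simp: bad_def V'_def)
  qed
  have "f e \<in> S_E" if "e \<in> E" for e
  proof (cases "e \<in> E'")
    case True
    then show ?thesis using f' ff' by (auto simp: near_sylvester_def)
  next
    case False
    then have "e \<in> {P, Q, A, B}" using that by (auto simp: E'_def)
    then show ?thesis using fv i(1) unfolding S_E_def by blast
  qed
  moreover have "card (bad V E ends f) \<le> card (bad V' E' ends f')"
    using bad fin by (intro card_mono) (auto simp: bad_def V'_def)
  then have "5 * card (bad V E ends f) \<le> card V" using f' cV by (auto simp: near_sylvester_def)
  moreover have "\<not> inj_on f (incid E ends v)" if "v \<in> bad V E ends f" for v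
  proof -
    have v: "v \<notin> {x, y, z}" using that good by (auto simp: bad_def)
    have "\<not> inj_on f' (incid E' ends v)" using that bad f' by (auto simp: near_sylvester_def)
    moreover have "inj_on f' (incid E' ends v) = inj_on f (incid E' ends v)"
      by (rule inj_on_cong) (simp add: ff' incid_def)
    ultimately show ?thesis using same[OF v] by simp
  qed
  moreover have "f ` incid E ends v \<subseteq> SZC ` {1, 2, 3}" if "v \<in> V" "card (incid E ends v) = 1" for v
  proof -
    have "card (incid E ends x) = 3" "card (incid E ends y) = 3" "card (incid E ends z) = 3"
      unfolding x y z using AB E(5) C by auto
    then have v: "v \<notin> {x, y, z}" using that(2) by auto
    then have "v \<in> V'" using that(1) by (simp add: V'_def)
    moreover have "card (incid E' ends v) = 1" using that(2) by (simp only: same[OF v])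
    moreover have "\<forall>v\<in>V'. card (incid E' ends v) = 1 \<longrightarrow> f' ` incid E' ends v \<subseteq> SZC ` {1, 2, 3}"
      using f' unfolding near_sylvester_def by (elim conjE)
    ultimately have "f' ` incid E' ends v \<subseteq> SZC ` {1, 2, 3}" by metis
    then show ?thesis by (simp only: img[OF v])
  qed
  ultimately have "near_sylvester V E ends f" by (auto simp: near_sylvester_def)
  then show ?thesis by blast
qed

text \<open>Contract the triangle to one vertex and extend the colouring by
  \<open>star_triangle_extension\<close>. A bad contracted vertex is replaced by at most one bad
  vertex of the triangle, a good one by none.\<close>

lemma near_sylvester_simple_triangle:
  fixes V :: "'v set" and E :: "'e set"
  assumes G: "leafed_cubic V E ends"
    and ne: "a \<noteq> b" "b \<noteq> c" "a \<noteq> c"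
    and E: "k1 \<in> E" "k2 \<in> E" "k3 \<in> E"
    and ends: "ends k1 = {b, c}" "ends k2 = {a, c}" "ends k3 = {a, b}"
    and simple: "\<And>e. e \<in> E \<Longrightarrow> ends e \<subseteq> {a, b, c} \<Longrightarrow> e \<in> {k1, k2, k3}"
    and IH: "\<And>(V' :: 'v set) (E' :: 'e set) ends'. card V' < card V \<Longrightarrow> leafed_cubic V' E' ends' \<Longrightarrow>
      \<exists>f. near_sylvester V' E' ends' f"
  shows "\<exists>f. near_sylvester V E ends f"
proof -
  have fin: "finite V" "finite E" and endsV: "\<And>e. e \<in> E \<Longrightarrow> ends e \<subseteq> V \<and> card (ends e) = 2"
    and deg: "\<And>v. v \<in> V \<Longrightarrow> card (incid E ends v) \<in> {1, 3}"
    using G by (auto simp: leafed_cubic_def multigraph_def)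
  have V: "a \<in> V" "b \<in> V" "c \<in> V" using endsV E ends by blast+
  have k: "k1 \<noteq> k2" "k1 \<noteq> k3" "k2 \<noteq> k3"
    using ends ne by (metis doubleton_eq_iff)+
  obtain ea where a: "incid E ends a = {k2, k3, ea}" and ea: "ea \<noteq> k2" "ea \<noteq> k3"
    by (rule third_edge[OF deg[OF V(1)], of k2 k3]) (use E ends k in \<open>auto simp: incid_def\<close>)
  obtain eb where b: "incid E ends b = {k1, k3, eb}" and eb: "eb \<noteq> k1" "eb \<noteq> k3"
    by (rule third_edge[OF deg[OF V(2)], of k1 k3]) (use E ends k in \<open>auto simp: incid_def\<close>)
  obtain ec where c: "incid E ends c = {k1, k2, ec}" and ec: "ec \<noteq> k1" "ec \<noteq> k2"
    by (rule third_edge[OF deg[OF V(3)], of k1 k2]) (use E ends k in \<open>auto simp: incid_def\<close>)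
  have eE: "ea \<in> E" "a \<in> ends ea" "eb \<in> E" "b \<in> ends eb" "ec \<in> E" "c \<in> ends ec"
    using a b c by (auto simp: incid_def)
  then have e': "ea \<noteq> k1" "eb \<noteq> k2" "ec \<noteq> k3" using ends ne by auto
  \<comment> \<open>The contracted vertex keeps the name \<open>a\<close>, and the edges keep
    theirs, so the smaller graph has the types of the induction hypothesis.\<close>
  define r where "r v = (if v \<in> {b, c} then a else v)" for v
  define ends' where "ends' e = r ` ends e" for e
  define V' where "V' = V - {b, c}"
  define E' where "E' = E - {k1, k2, k3}"
  have two: "\<exists>v w. ends e = {v, w} \<and> v \<noteq> w" if "e \<in> E" for e
    using endsV[OF that] by (auto simp: card_2_iff)
  \<comment> \<open>An edge besides the three sides has at most one end in the triangle. Hence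
    contraction makes no loop and the three outer edges are distinct.\<close>
  have pair: False if "e \<in> E'" "s \<in> ends e" "t \<in> ends e" "s \<noteq> t" "s \<in> {a, b, c}" "t \<in> {a, b, c}" for e s t
  proof -
    have "ends e \<subseteq> {a, b, c}" using two[of e] that by (auto simp: E'_def)
    then show False using simple that by (auto simp: E'_def)
  qed
  have eE': "ea \<in> E'" "eb \<in> E'" "ec \<in> E'" using eE ea eb ec e' by (auto simp: E'_def)
  have dist: "ea \<noteq> eb" "eb \<noteq> ec" "ea \<noteq> ec"
    using pair[OF eE'(1), of a b] pair[OF eE'(1), of a c] pair[OF eE'(2), of b c] eE ne by auto
  have a': "incid E' ends' a = {ea, eb, ec}"
  proof -
    have "e \<in> incid E' ends' a \<longleftrightarrow> e \<in> E' \<and> (e \<in> incid E ends a \<or> e \<in> incid E ends b \<or> e \<in> incid E ends c)" for e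
      by (auto simp: incid_def ends'_def r_def E'_def)
    then show ?thesis using eE' unfolding a b c by (auto simp: E'_def)
  qed
  have same: "incid E' ends' v = incid E ends v" if "v \<notin> {a, b, c}" for v
    using that ends by (auto simp: incid_def E'_def ends'_def r_def)
  have "ends' e \<subseteq> V' \<and> card (ends' e) = 2" if "e \<in> E'" for e
  proof -
    have "e \<in> E" using that by (simp add: E'_def)
    then obtain v w where vw: "ends e = {v, w}" "v \<noteq> w" using two by blast
    then have "r v \<noteq> r w" using pair[OF that, of v w] by (auto simp: r_def)
    moreover have "v \<in> V" "w \<in> V" using vw endsV[OF \<open>e \<in> E\<close>] by auto
    then have "r v \<in> V'" "r w \<in> V'" using V ne by (simp_all add: V'_def r_def)
    ultimately show ?thesis using vw by (simp add: ends'_def)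
  qed
  moreover have "card (incid E' ends' v) \<in> {1, 3}" if "v \<in> V'" for v
    using that a' dist same[of v] deg[of v] by (cases "v = a") (auto simp: V'_def)
  ultimately have "leafed_cubic V' E' ends'"
    using fin by (auto simp: leafed_cubic_def multigraph_def V'_def E'_def)
  moreover have "V' \<subset> V" using V by (auto simp: V'_def)
  then have cV: "card V' < card V" using fin by (simp add: psubset_card_mono)
  ultimately obtain f' where f': "near_sylvester V' E' ends' f'" using IH by blast
  have a_bad: "a \<in> bad V' E' ends' f' \<longleftrightarrow> {f' ea, f' eb, f' ec} \<notin> stars"
    using a' dist V ne by (auto simp: bad_def V'_def)
  \<comment> \<open>If the contracted vertex is bad, the induction hypothesis guarantees a repeated
    colour there.\<close>
  have "{f' ea, f' eb, f' ec} \<in> stars \<or> f' ea = f' eb \<or> f' eb = f' ec \<or> f' ea = f' ec"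
  proof (rule ccontr)
    assume *: "\<not> ?thesis"
    then have "\<not> inj_on f' {ea, eb, ec}" using f' a_bad a' by (auto simp: near_sylvester_def)
    then show False using * by (auto simp: inj_on_def)
  qed
  moreover have "f' ea \<in> S_E" "f' eb \<in> S_E" "f' ec \<in> S_E"
    using f' eE' by (auto simp: near_sylvester_def)
  ultimately obtain t1 t2 t3 where tS: "t1 \<in> S_E" "t2 \<in> S_E" "t3 \<in> S_E"
    and t: "{f' ea, t2, t3} \<in> stars \<or> t2 = t3" "{f' eb, t1, t3} \<in> stars \<or> t1 = t3" "{f' ec, t1, t2} \<in> stars \<or> t1 = t2"
    and t_good: "{f' ea, f' eb, f' ec} \<in> stars \<Longrightarrow>
       {f' ea, t2, t3} \<in> stars \<and> {f' eb, t1, t3} \<in> stars \<and> {f' ec, t1, t2} \<in> stars"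
    and t_two: "{f' ea, t2, t3} \<in> stars \<and> {f' eb, t1, t3} \<in> stars \<or> {f' eb, t1, t3} \<in> stars \<and> {f' ec, t1, t2} \<in> stars
      \<or> {f' ea, t2, t3} \<in> stars \<and> {f' ec, t1, t2} \<in> stars"
    using star_triangle_extension[of "f' ea" "f' eb" "f' ec"] by metis
  define f where "f = f'(k1 := t1, k2 := t2, k3 := t3)"
  have fk: "f k1 = t1" "f k2 = t2" "f k3 = t3" using k by (auto simp: f_def)
  have ff': "f e = f' e" if "e \<in> E'" for e using that by (auto simp: f_def E'_def)
  have img: "f ` incid E ends v = f' ` incid E' ends' v" if "v \<notin> {a, b, c}" for v
    unfolding same[OF that, symmetric] by (rule image_cong) (auto simp: ff' incid_def)
  have imgs: "f ` incid E ends a = {f' ea, t2, t3}" "f ` incid E ends b = {f' eb, t1, t3}"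
      "f ` incid E ends c = {f' ec, t1, t2}"
    unfolding a b c using fk ff' eE' by auto
  \<comment> \<open>The bad vertices of the triangle, to be charged to the contracted vertex
    \<open>a\<close>.\<close>
  define W where "W = {v \<in> {a, b, c}. f ` incid E ends v \<notin> stars}"
  have W: "\<exists>w. W \<subseteq> {w}" using t_two imgs unfolding W_def by auto
  have W0: "W = {}" if "a \<notin> bad V' E' ends' f'"
    using t_good that a_bad imgs unfolding W_def by auto
  have finbad: "finite (bad V' E' ends' f')" using fin by (simp add: bad_def V'_def)
  have bad: "v \<in> bad V' E' ends' f'" if "v \<in> bad V E ends f" "v \<notin> {a, b, c}" for v
    using that img[of v] same[of v] by (auto simp: bad_def V'_def)
  then have bad_sub: "bad V E ends f \<subseteq> (bad V' E' ends' f' - {a}) \<union> W"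
    by (auto simp: W_def bad_def)
  have "card (bad V E ends f) \<le> card (bad V' E' ends' f')"
  proof (cases "a \<in> bad V' E' ends' f'")
    case True
    obtain w where "W \<subseteq> {w}" using W by blast
    then have "bad V E ends f \<subseteq> insert w (bad V' E' ends' f' - {a})" using bad_sub by blast
    then have "card (bad V E ends f) \<le> card (insert w (bad V' E' ends' f' - {a}))"
      using finbad by (intro card_mono) auto
    also have "\<dots> \<le> Suc (card (bad V' E' ends' f' - {a}))" by (rule card_insert_le_m1) auto
    also have "\<dots> = card (bad V' E' ends' f')" using True finbad by (metis card_Suc_Diff1)
    finally show ?thesis .
  next
    case False
    then show ?thesis using bad_sub W0 finbad by (intro card_mono) auto
  qed
  then have "5 * card (bad V E ends f) \<le> card V" using f' cV by (auto simp: near_sylvester_def)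
  moreover have "f e \<in> S_E" if "e \<in> E" for e
  proof (cases "e \<in> E'")
    case True
    then show ?thesis using f' ff' by (auto simp: near_sylvester_def)
  next
    case False
    then have "e \<in> {k1, k2, k3}" using that by (auto simp: E'_def)
    then show ?thesis using fk tS by blast
  qed
  moreover have "\<not> inj_on f (incid E ends v)" if v: "v \<in> bad V E ends f" for v
  proof (cases "v \<in> {a, b, c}")
    case True
    have nb: "f ` incid E ends v \<notin> stars" using v by (simp add: bad_def)
    consider "v = a" | "v = b" | "v = c" using True by blast
    then show ?thesis
    proof cases
      case 1
      then have "f k2 = f k3" using nb imgs t fk by auto
      then show ?thesis using 1 a k by (auto simp: inj_on_def)
    next
      case 2
      then have "f k1 = f k3" using nb imgs t fk by auto
      then show ?thesis using 2 b k by (auto simp: inj_on_def)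
    next
      case 3
      then have "f k1 = f k2" using nb imgs t fk by auto
      then show ?thesis using 3 c k by (auto simp: inj_on_def)
    qed
  next
    case False
    have "\<not> inj_on f' (incid E' ends' v)" using bad[OF v False] f' by (auto simp: near_sylvester_def)
    moreover have "inj_on f' (incid E' ends' v) = inj_on f (incid E' ends' v)"
      by (rule inj_on_cong) (simp add: ff' incid_def)
    ultimately show ?thesis using same[OF False] by simp
  qed
  moreover have "f ` incid E ends v \<subseteq> SZC ` {1, 2, 3}" if "v \<in> V" "card (incid E ends v) = 1" for v
  proof -
    have "card (incid E ends a) = 3" "card (incid E ends b) = 3" "card (incid E ends c) = 3"
      unfolding a b c using k ea eb ec by auto
    then have v: "v \<notin> {a, b, c}" using that(2) by auto
    then have "v \<in> V'" using that(1) by (simp add: V'_def)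
    moreover have "card (incid E' ends' v) = 1" using that(2) by (simp only: same[OF v])
    moreover have "\<forall>v\<in>V'. card (incid E' ends' v) = 1 \<longrightarrow> f' ` incid E' ends' v \<subseteq> SZC ` {1, 2, 3}"
      using f' unfolding near_sylvester_def by (elim conjE)
    ultimately have "f' ` incid E' ends' v \<subseteq> SZC ` {1, 2, 3}" by metis
    then show ?thesis by (simp only: img[OF v])
  qed
  ultimately have "near_sylvester V E ends f" by (auto simp: near_sylvester_def)
  then show ?thesis by blast
qed

theorem leafed_cubic_near_sylvester:
  fixes V :: "'v set" and E :: "'e set"
  assumes "leafed_cubic V E ends"
  shows "\<exists>f. near_sylvester V E ends f"
  using assms
proof (induction "card V" arbitrary: V E ends rule: less_induct)
  case less
  have IH: "\<exists>f. near_sylvester V' E' ends' f" if "card V' < card V" "leafed_cubic V' E' ends'"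
    for V' :: "'v set" and E' :: "'e set" and ends'
    using less.hyps[OF that(1) that(2)] .
  show ?case
  proof (cases "\<exists>x y z. triangle E ends x y z")
    case False
    then show ?thesis using near_sylvester_triangle_free less.prems by blast
  next
    case True
    then obtain a b c k1 k2 k3 where k: "k1 \<in> E" "k2 \<in> E" "k3 \<in> E"
      and ends: "ends k1 = {b, c}" "ends k2 = {a, c}" "ends k3 = {a, b}"
      unfolding triangle_def by blast
    have card2: "card (ends e) = 2" if "e \<in> E" for e
      using less.prems that by (auto simp: leafed_cubic_def multigraph_def)
    have ne: "a \<noteq> b" "b \<noteq> c" "a \<noteq> c"
      using card2[OF k(1)] card2[OF k(2)] card2[OF k(3)] ends by auto
    show ?thesis
    proof (cases "\<forall>e\<in>E. ends e \<subseteq> {a, b, c} \<longrightarrow> e \<in> {k1, k2, k3}")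
      case True
      then show ?thesis
        using near_sylvester_simple_triangle[OF less.prems ne k ends _ IH] by blast
    next
      case False
      \<comment> \<open>A fourth edge inside the triangle is parallel to one side; the vertex
        opposite that side becomes \<open>z\<close> of the doubled triangle.\<close>
      then obtain e where e: "e \<in> E" "ends e \<subseteq> {a, b, c}" "k1 \<noteq> e" "k2 \<noteq> e" "k3 \<noteq> e" by blast
      obtain s t where st: "ends e = {s, t}" "s \<noteq> t" using card2[OF e(1)] by (auto simp: card_2_iff)
      have sym: "ends k1 = {c, b}" "ends k2 = {c, a}" "ends k3 = {b, a}" using ends by auto
      consider "ends e = {b, c}" | "ends e = {a, c}" | "ends e = {a, b}" using e(2) st by auto
      then show ?thesis
      proof cases
        case 1
        show ?thesis
          by (rule near_sylvester_doubled_triangle[OF less.prems, of b c a k1 e k3 k2])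
            (use ne k e ends sym 1 IH in auto)
      next
        case 2
        show ?thesis
          by (rule near_sylvester_doubled_triangle[OF less.prems, of a c b k2 e k3 k1])
            (use ne k e ends sym 2 IH in auto)
      next
        case 3
        show ?thesis
          by (rule near_sylvester_doubled_triangle[OF less.prems, of a b c k3 e k2 k1])
            (use ne k e ends sym 3 IH in auto)
      qed
    qed
  qed
qed

theorem theorem6:
  fixes V :: "'v set" and E :: "'e set" and ends :: "'e \<Rightarrow> 'v set"
  assumes "cubic V E ends"
  shows "\<exists>f :: 'e \<Rightarrow> se. f ` E \<subseteq> S_E \<and>
           5 * card (Vf V E ends f) \<ge> 4 * card V \<and>
           (\<forall>v \<in> V - Vf V E ends f. \<exists>e \<in> incid E ends v. \<exists>e' \<in> incid E ends v.
               e \<noteq> e' \<and> f e = f e')"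
proof -
  have "leafed_cubic V E ends" using assms by (simp add: cubic_def leafed_cubic_def)
  then obtain f where f: "near_sylvester V E ends f" using leafed_cubic_near_sylvester by blast
  have "finite V" using assms by (simp add: cubic_def multigraph_def)
  have "Vf V E ends f = {v \<in> V. f ` incid E ends v \<in> stars}"
    by (auto simp: Vf_def stars_def)
  \<comment> \<open>In a cubic graph there are no leaves, so the bad vertices are exactly those
    outside \<open>Vf\<close>.\<close>
  then have bad: "V - Vf V E ends f = bad V E ends f"
    using assms by (auto simp: bad_def cubic_def)
  have "Vf V E ends f \<subseteq> V" by (auto simp: Vf_def)
  then have "card V = card (Vf V E ends f) + card (bad V E ends f)"
    using \<open>finite V\<close> bad by (metis card_Diff_subset card_mono finite_subset le_add_diff_inverse)
  then have "5 * card (Vf V E ends f) \<ge> 4 * card V"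
    using f by (simp add: near_sylvester_def)
  moreover have "\<exists>e \<in> incid E ends v. \<exists>e' \<in> incid E ends v. e \<noteq> e' \<and> f e = f e'"
    if "v \<in> V - Vf V E ends f" for v
    using f that unfolding bad near_sylvester_def inj_on_def by blast
  ultimately show ?thesis using f by (auto simp: near_sylvester_def)
qed

end
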